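(* Fix an integer $n \ge 2$. For a positive integer $r$, let $m(n,r)$ denote the minimal number of edges in an $n$-uniform hypergraph whose chromatic number is greater than $r$. Then the sequence $a_r := m(n,r)/r^n$ ($r = 1,2,\dots$) has a limit as $r \to \infty$.
   Context: A hypergraph $H=(V,E)$ consists of a finite vertex set $V$ and a family $E$ of subsets of $V$ (edges); it is $n$-uniform if every edge has exactly $n$ elements. An $r$-coloring is a map $V\to\{1,\dots,r\}$; it is proper if no edge is monochromatic (every edge contains two vertices of different colors). The chromatic number $\chi(H)$ is the least $r$ for which a proper $r$-coloring exists. *)

theory Defs
  imports Complex_Main "HOL-Library.FuncSet"
begin

definition hypergraph :: "'a set \<Rightarrow> 'a set set \<Rightarrow> bool" where
  "hypergraph V E \<longleftrightarrow> finite V \<and> E \<subseteq> Pow V"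

definition uniform :: "nat \<Rightarrow> 'a set set \<Rightarrow> bool" where
  "uniform n E \<longleftrightarrow> (\<forall>e\<in>E. card e = n)"

definition coloring :: "'a set \<Rightarrow> nat \<Rightarrow> ('a \<Rightarrow> nat) \<Rightarrow> bool" where
  "coloring V r f \<longleftrightarrow> f \<in> V \<rightarrow> {1..r}"

definition proper :: "'a set set \<Rightarrow> ('a \<Rightarrow> nat) \<Rightarrow> bool" where
  "proper E f \<longleftrightarrow> (\<forall>e\<in>E. \<exists>x\<in>e. \<exists>y\<in>e. f x \<noteq> f y)"

text \<open>
  Meaningful when every edge has at least two elements: then an injective coloring
  is proper, so the least number exists. With an edge of size at most one there is
  no proper coloring at all.
\<close>

definition chromatic_number :: "'a set \<Rightarrow> 'a set set \<Rightarrow> nat" where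
  "chromatic_number V E = (LEAST r. \<exists>f. coloring V r f \<and> proper E f)"

text \<open>
  Vertices are taken in \<^typ>\<open>nat\<close>; since vertex sets are finite, every hypergraph
  is isomorphic to one of this kind. For \<open>n \<ge> 2\<close> the least number exists, witnessed by
  all \<open>n\<close>-subsets of a set of \<open>r * (n - 1) + 1\<close> vertices.
\<close>

definition m :: "nat \<Rightarrow> nat \<Rightarrow> nat" where
  "m n r = (LEAST k. \<exists>(V :: nat set) E.
     hypergraph V E \<and> uniform n E \<and> chromatic_number V E > r \<and> card E = k)"

end

theory Submission
  imports Defs
begin

text \<open>
  Let \<open>f N\<close> be the largest chromatic number of an \<open>n\<close>-uniform hypergraph with at most \<open>N\<close>
  edges, so that \<open>N < m n r\<close> iff \<open>f N \<le> r\<close>. Partitioning the vertices at random into \<open>k\<close> parts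
  leaves on average at most \<open>N / k ^ (n - 1)\<close> edges inside parts; coloring the parts with disjoint
  palettes gives \<open>f N \<le> f a\<^sub>1 + \<dots> + f a\<^sub>k\<close> for some \<open>a\<^sub>1 + \<dots> + a\<^sub>k \<le> N / k ^ (n - 1)\<close>.

  Hence an affine bound \<open>f a \<le> \<alpha> + \<beta> * a\<close> gives \<open>f N \<le> \<alpha> * k + \<beta> * N / k ^ (n - 1)\<close>; with \<open>k\<close> close to
  \<open>root n N / s\<close>, the limit superior \<open>u\<close> of \<open>f N / root n N\<close> is at most \<open>\<alpha> / s + \<beta> * s ^ (n - 1)\<close>,
  the value at \<open>a = s ^ n\<close> of the affine function over \<open>s\<close>. If \<open>f x \<le> l * root n x\<close> for some \<open>l < u\<close>
  and arbitrarily large \<open>x\<close>, let \<open>s ^ n\<close> be slightly below such an \<open>x\<close>. The tangent to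
  \<open>u * root n a\<close> at \<open>a = s ^ n\<close> can then be lowered and still dominate \<open>f\<close>: away from \<open>s ^ n\<close> by
  strict concavity, and near \<open>s ^ n\<close> because \<open>f \<le> f x\<close> below \<open>x\<close>. This contradicts the choice of \<open>u\<close>.
  So \<open>f N / root n N\<close> converges; its limit is positive by the complete hypergraphs, and inverting \<open>f\<close>
  gives the limit of \<open>m n r / r ^ n\<close>.
\<close>

section \<open>Colorability\<close>

lemma finite_hypergraph_edges: "hypergraph V E \<Longrightarrow> finite E"
  unfolding hypergraph_def by (meson finite_Pow_iff finite_subset)

definition colorable :: "'a set \<Rightarrow> 'a set set \<Rightarrow> nat \<Rightarrow> bool" where
  "colorable V E r \<longleftrightarrow> (\<exists>c. coloring V r c \<and> proper E c)"

lemma colorable_mono: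
  assumes "colorable V E r" "r \<le> s"
  shows "colorable V E s"
proof -
  have "{1..r} \<subseteq> {1..s}" using assms(2) by auto
  then show ?thesis using assms(1) unfolding colorable_def coloring_def by blast
qed

lemma colorable_insert_edge:
  assumes "colorable V E r" and edges_in_V: "insert d E \<subseteq> Pow V"
    and two_vertices: "\<And>e. e \<in> insert d E \<Longrightarrow> 2 \<le> card e"
  shows "colorable V (insert d E) (Suc r)"
proof -
  obtain c where c_range: "c \<in> V \<rightarrow> {1..r}" and c_proper: "proper E c"
    using assms(1) unfolding colorable_def coloring_def by blast
  have other_vertex: "\<exists>y\<in>e. y \<noteq> x" if "e \<in> insert d E" for e x
    using two_vertices[OF that] card_mono[of "{x}" e] by fastforce
  then obtain p where "p \<in> d" by blast
  let ?c = "c(p := Suc r)"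
  have "\<exists>x\<in>e. \<exists>y\<in>e. ?c x \<noteq> ?c y" if e: "e \<in> insert d E" for e
  proof (cases "p \<in> e")
    case True
    obtain y where y: "y \<in> e" "y \<noteq> p" using other_vertex[OF e] by blast
    then have "c y \<noteq> Suc r" using c_range e edges_in_V by (fastforce simp: Pi_def)
    then show ?thesis using True y by force
  next
    case False
    then have "\<exists>x\<in>e. \<exists>y\<in>e. c x \<noteq> c y"
      using c_proper \<open>p \<in> d\<close> e unfolding proper_def by blast
    then show ?thesis using False by force
  qed
  moreover have "?c \<in> V \<rightarrow> {1..Suc r}"
    using c_range by (fastforce simp: Pi_def)
  ultimately show ?thesis unfolding colorable_def coloring_def proper_def by blast
qed

lemma colorable_Suc_card_edges:
  assumes "hypergraph V E" "\<And>e. e \<in> E \<Longrightarrow> 2 \<le> card e"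
  shows "colorable V E (Suc (card E))"
proof -
  have "finite E" by (rule finite_hypergraph_edges[OF assms(1)])
  then show ?thesis using assms
  proof (induction E rule: finite_induct)
    case empty
    show ?case by (auto simp: colorable_def coloring_def proper_def)
  next
    case (insert d E)
    then have "colorable V (insert d E) (Suc (Suc (card E)))"
      by (intro colorable_insert_edge) (auto simp: hypergraph_def)
    then show ?case using insert.hyps by simp
  qed
qed

lemma chromatic_number_le_iff_colorable:
  assumes "hypergraph V E" "\<And>e. e \<in> E \<Longrightarrow> 2 \<le> card e"
  shows "chromatic_number V E \<le> r \<longleftrightarrow> colorable V E r"
proof -
  have least: "chromatic_number V E = (LEAST r. colorable V E r)"
    unfolding chromatic_number_def colorable_def ..
  have "colorable V E (chromatic_number V E)"
    unfolding least by (rule LeastI, rule colorable_Suc_card_edges[OF assms])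
  then show ?thesis using colorable_mono least by (metis Least_le)
qed

lemma chromatic_number_le_Suc_card_edges:
  assumes "hypergraph V E" "\<And>e. e \<in> E \<Longrightarrow> 2 \<le> card e"
  shows "chromatic_number V E \<le> Suc (card E)"
  using colorable_Suc_card_edges[OF assms] chromatic_number_le_iff_colorable[OF assms] by blast

lemma colorable_disjoint_palettes:
  assumes "colorable (V \<inter> A) (E \<inter> Pow A) r" "colorable (V - A) (E \<inter> Pow (- A)) s"
    and "E \<subseteq> Pow V"
  shows "colorable V E (r + s)"
proof -
  obtain b where b_range: "b \<in> V \<inter> A \<rightarrow> {1..r}" and b_proper: "proper (E \<inter> Pow A) b"
    using assms(1) unfolding colorable_def coloring_def by blast
  obtain c where c_range: "c \<in> V - A \<rightarrow> {1..s}" and c_proper: "proper (E \<inter> Pow (- A)) c"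
    using assms(2) unfolding colorable_def coloring_def by blast
  define d where "d x = (if x \<in> A then b x else r + c x)" for x
  have low: "d x \<in> {1..r}" if "x \<in> V" "x \<in> A" for x
    using b_range that by (auto simp: d_def)
  have high: "d x \<in> {r + 1..r + s}" if "x \<in> V" "x \<notin> A" for x
    using c_range that by (auto simp: d_def)
  have "\<exists>x\<in>e. \<exists>y\<in>e. d x \<noteq> d y" if e: "e \<in> E" for e
  proof -
    consider (inside) "e \<subseteq> A" | (outside) "e \<subseteq> - A"
      | (crossing) x y where "x \<in> e" "x \<in> A" "y \<in> e" "y \<notin> A" by blast
    then show ?thesis
    proof cases
      case inside
      then obtain x y where "x \<in> e" "y \<in> e" "b x \<noteq> b y"
        using b_proper e unfolding proper_def by blast
      then show ?thesis using inside by (force simp: d_def)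
    next
      case outside
      then obtain x y where "x \<in> e" "y \<in> e" "c x \<noteq> c y"
        using c_proper e unfolding proper_def by blast
      moreover from this have "x \<notin> A" "y \<notin> A" using outside by auto
      ultimately show ?thesis by (force simp: d_def)
    next
      case crossing
      then have "d x \<noteq> d y" using low[of x] high[of y] e assms(3) by fastforce
      then show ?thesis using crossing by blast
    qed
  qed
  moreover have "d \<in> V \<rightarrow> {1..r + s}" using low high by fastforce
  ultimately show ?thesis unfolding colorable_def coloring_def proper_def by blast
qed

lemma colorable_partition:
  assumes "finite B" "g \<in> V \<rightarrow> B" "E \<subseteq> Pow V" "{} \<notin> E"
    and "\<And>i. i \<in> B \<Longrightarrow> colorable (V \<inter> g -` {i}) (E \<inter> Pow (g -` {i})) (R i)"
  shows "colorable V E (\<Sum>i\<in>B. R i)"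
  using assms
proof (induction B arbitrary: V E rule: finite_induct)
  case empty
  then have "V = {}" by auto
  then have "E = {}" using empty by auto
  then show ?case using empty by (auto simp: colorable_def coloring_def proper_def)
next
  case (insert j B)
  let ?A = "g -` {j}"
  have "colorable (V - ?A) (E \<inter> Pow (- ?A)) (\<Sum>i\<in>B. R i)"
  proof (rule insert.IH)
    fix i assume i: "i \<in> B"
    have "(V - ?A) \<inter> g -` {i} = V \<inter> g -` {i}"
      "E \<inter> Pow (- ?A) \<inter> Pow (g -` {i}) = E \<inter> Pow (g -` {i})"
      using i insert.hyps by auto
    then show "colorable ((V - ?A) \<inter> g -` {i}) (E \<inter> Pow (- ?A) \<inter> Pow (g -` {i})) (R i)"
      using insert.prems i by simp
  qed (use insert.prems in auto)
  then have "colorable V E (R j + (\<Sum>i\<in>B. R i))"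
    using insert.prems by (intro colorable_disjoint_palettes) auto
  then show ?case using insert.hyps by simp
qed

lemma complete_not_colorable:
  assumes "finite V" "r * (n - 1) < card V"
  shows "\<not> colorable V {e. e \<subseteq> V \<and> card e = n} r"
proof
  assume "colorable V {e. e \<subseteq> V \<and> card e = n} r"
  then obtain c where c_range: "c \<in> V \<rightarrow> {1..r}" and c_proper: "proper {e. e \<subseteq> V \<and> card e = n} c"
    unfolding colorable_def coloring_def by blast
  have "V \<noteq> {}" using assms(2) by auto
  then have "{1..r} \<noteq> {}" using c_range by auto
  then obtain i where "card V \<le> card (c -` {i} \<inter> V) * r"
    using pigeonhole_card[OF c_range assms(1)] by auto
  with assms(2) have "r * (n - 1) < r * card (c -` {i} \<inter> V)" by (simp only: mult.commute)
  then have "n - 1 < card (c -` {i} \<inter> V)" by simp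
  then have "n \<le> card (c -` {i} \<inter> V)" by linarith
  then obtain e where "e \<subseteq> c -` {i} \<inter> V" "card e = n" by (meson obtain_subset_with_card_n)
  then show False using c_proper unfolding proper_def by blast
qed

section \<open>Extremal hypergraphs\<close>

definition uniform_chromatic_numbers :: "nat \<Rightarrow> nat \<Rightarrow> nat set" where
  "uniform_chromatic_numbers n N = {chromatic_number V E | (V :: nat set) E.
     hypergraph V E \<and> uniform n E \<and> card E \<le> N}"

definition max_chromatic :: "nat \<Rightarrow> nat \<Rightarrow> nat" where
  "max_chromatic n N = Max (uniform_chromatic_numbers n N)"

lemma uniform_chromatic_numbers_subset_atMost:
  assumes "2 \<le> n"
  shows "uniform_chromatic_numbers n N \<subseteq> {..Suc N}"
proof -
  have "chromatic_number V E \<le> Suc N" if "hypergraph V E" "uniform n E" "card E \<le> N"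
    for V :: "nat set" and E
    using chromatic_number_le_Suc_card_edges[of V E] that assms by (simp add: uniform_def)
  then show ?thesis by (auto simp: uniform_chromatic_numbers_def)
qed

lemma finite_uniform_chromatic_numbers: "2 \<le> n \<Longrightarrow> finite (uniform_chromatic_numbers n N)"
  using uniform_chromatic_numbers_subset_atMost finite_subset by blast

lemma max_chromatic_in_uniform_chromatic_numbers:
  assumes "2 \<le> n"
  shows "max_chromatic n N \<in> uniform_chromatic_numbers n N"
proof -
  have "hypergraph {} {}" "uniform n {}" by (auto simp: hypergraph_def uniform_def)
  then have "uniform_chromatic_numbers n N \<noteq> {}" unfolding uniform_chromatic_numbers_def by force
  then show ?thesis
    unfolding max_chromatic_def by (intro Max_in finite_uniform_chromatic_numbers[OF assms])
qed

lemma max_chromatic_attained: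
  assumes "2 \<le> n"
  obtains V :: "nat set" and E where "hypergraph V E" "uniform n E" "card E \<le> N"
    "chromatic_number V E = max_chromatic n N"
  using max_chromatic_in_uniform_chromatic_numbers[OF assms, of N] unfolding uniform_chromatic_numbers_def by force

lemma chromatic_number_le_max_chromatic:
  fixes V :: "nat set"
  assumes "2 \<le> n" "hypergraph V E" "uniform n E" "card E \<le> N"
  shows "chromatic_number V E \<le> max_chromatic n N"
  unfolding max_chromatic_def
  using assms by (intro Max_ge finite_uniform_chromatic_numbers) (auto simp: uniform_chromatic_numbers_def)

lemma max_chromatic_le_Suc: "2 \<le> n \<Longrightarrow> max_chromatic n N \<le> Suc N"
  using uniform_chromatic_numbers_subset_atMost max_chromatic_in_uniform_chromatic_numbers by blast

lemma max_chromatic_mono: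
  assumes "2 \<le> n" "N \<le> N'"
  shows "max_chromatic n N \<le> max_chromatic n N'"
  unfolding max_chromatic_def
proof (rule Max_mono)
  show "uniform_chromatic_numbers n N \<subseteq> uniform_chromatic_numbers n N'"
    using assms(2) by (force simp: uniform_chromatic_numbers_def)
  show "uniform_chromatic_numbers n N \<noteq> {}"
    using max_chromatic_in_uniform_chromatic_numbers[OF assms(1)] by blast
qed (rule finite_uniform_chromatic_numbers[OF assms(1)])

lemma complete_hypergraph_chromatic_number_gt:
  assumes "2 \<le> n" "finite V" "r * (n - 1) < card V"
  shows "r < chromatic_number V {e. e \<subseteq> V \<and> card e = n}"
proof -
  let ?E = "{e. e \<subseteq> V \<and> card e = n}"
  have "hypergraph V ?E" using assms(2) by (auto simp: hypergraph_def)
  then have "chromatic_number V ?E \<le> r \<longleftrightarrow> colorable V ?E r"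
    using assms(1) by (intro chromatic_number_le_iff_colorable) auto
  then show ?thesis using complete_not_colorable[OF assms(2,3)] by simp
qed

lemma complete_hypergraph_witness:
  assumes "2 \<le> n"
  shows "\<exists>(V :: nat set) E. hypergraph V E \<and> uniform n E \<and> r < chromatic_number V E
           \<and> card E = Suc (r * (n - 1)) choose n"
proof (intro exI conjI)
  let ?V = "{..r * (n - 1)}" and ?E = "{e. e \<subseteq> {..r * (n - 1)} \<and> card e = n}"
  show "hypergraph ?V ?E" "uniform n ?E" by (auto simp: hypergraph_def uniform_def)
  show "r < chromatic_number ?V ?E"
    using assms by (intro complete_hypergraph_chromatic_number_gt) auto
  show "card ?E = Suc (r * (n - 1)) choose n" by (simp add: n_subsets)
qed

lemma m_attained:
  assumes "2 \<le> n"
  obtains V :: "nat set" and E where "hypergraph V E" "uniform n E"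
    "r < chromatic_number V E" "card E = m n r"
proof -
  have "\<exists>(V :: nat set) E. hypergraph V E \<and> uniform n E \<and> r < chromatic_number V E \<and> card E = m n r"
    unfolding m_def by (rule LeastI_ex) (use complete_hypergraph_witness[OF assms] in blast)
  then show ?thesis using that by blast
qed

lemma m_le_card_edges:
  fixes V :: "nat set"
  assumes "hypergraph V E" "uniform n E" "r < chromatic_number V E"
  shows "m n r \<le> card E"
  unfolding m_def by (rule Least_le) (use assms in blast)

lemma m_le_power:
  assumes "2 \<le> n" "1 \<le> r"
  shows "m n r \<le> (r * n) ^ n"
proof -
  have "m n r \<le> Suc (r * (n - 1)) choose n"
    using complete_hypergraph_witness[OF assms(1)] m_le_card_edges by metis
  also have "\<dots> \<le> Suc (r * (n - 1)) ^ n"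
    by (metis binomial_eq_0 binomial_le_pow le0 not_le)
  also have "\<dots> \<le> (r * n) ^ n"
    using assms by (intro power_mono) (auto simp: diff_mult_distrib2 Suc_le_eq)
  finally show ?thesis .
qed

lemma less_m_iff_max_chromatic_le:
  assumes "2 \<le> n"
  shows "N < m n r \<longleftrightarrow> max_chromatic n N \<le> r"
proof
  assume "N < m n r"
  obtain V :: "nat set" and E where "hypergraph V E" "uniform n E" "card E \<le> N"
    and "chromatic_number V E = max_chromatic n N"
    by (rule max_chromatic_attained[OF assms])
  then show "max_chromatic n N \<le> r"
    using m_le_card_edges[of V E n r] \<open>N < m n r\<close> by linarith
next
  assume "max_chromatic n N \<le> r"
  obtain V :: "nat set" and E where "hypergraph V E" "uniform n E"
    and "r < chromatic_number V E" "card E = m n r"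
    by (rule m_attained[OF assms])
  then show "N < m n r"
    using chromatic_number_le_max_chromatic[OF assms, of V E N] \<open>max_chromatic n N \<le> r\<close> by linarith
qed

section \<open>Random partitions\<close>

lemma card_PiE_constant_on:
  assumes "finite V" "e \<subseteq> V" "i \<in> B"
  shows "card {g \<in> V \<rightarrow>\<^sub>E B. e \<subseteq> g -` {i}} = card B ^ card (V - e)"
proof -
  have "{g \<in> V \<rightarrow>\<^sub>E B. e \<subseteq> g -` {i}} = (\<Pi>\<^sub>E x\<in>V. if x \<in> e then {i} else B)"
    using assms by (auto simp: PiE_iff extensional_def split: if_splits)
  also have "card \<dots> = (\<Prod>x\<in>V. if x \<in> e then 1 else card B)"
    using assms(1) by (simp add: card_PiE if_distrib cong: if_cong)
  also have "\<dots> = (\<Prod>x\<in>V - e. card B)"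
    using assms by (intro prod.mono_neutral_cong_right) auto
  finally show ?thesis by simp
qed

lemma sum_card_edges_inside_parts:
  assumes "hypergraph V E" "uniform n E" "1 \<le> n" "finite B"
  shows "(\<Sum>g\<in>V \<rightarrow>\<^sub>E B. \<Sum>i\<in>B. card (E \<inter> Pow (g -` {i}))) * card B ^ (n - 1)
    = card (V \<rightarrow>\<^sub>E B) * card E"
proof -
  have "finite V" "E \<subseteq> Pow V" using assms(1) by (auto simp: hypergraph_def)
  have "finite E" by (rule finite_hypergraph_edges[OF assms(1)])
  have "finite (V \<rightarrow>\<^sub>E B)" using \<open>finite V\<close> assms(4) by (simp add: finite_PiE)
  have "(\<Sum>g\<in>V \<rightarrow>\<^sub>E B. card (E \<inter> Pow (g -` {i}))) = card B ^ (card V - n) * card E" if "i \<in> B" for i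
  proof -
    have "card {g \<in> V \<rightarrow>\<^sub>E B. e \<subseteq> g -` {i}} = card B ^ (card V - n)" if "e \<in> E" for e
      using card_PiE_constant_on[of V e i B] \<open>finite V\<close> \<open>E \<subseteq> Pow V\<close> \<open>i \<in> B\<close> assms(2) that
      by (auto simp: uniform_def card_Diff_subset finite_subset)
    then have "(\<Sum>g\<in>V \<rightarrow>\<^sub>E B. card {e \<in> E. e \<subseteq> g -` {i}}) = card B ^ (card V - n) * card E"
      using \<open>finite E\<close> \<open>finite (V \<rightarrow>\<^sub>E B)\<close> by (intro sum_multicount) auto
    then show ?thesis by (simp add: Int_def)
  qed
  then have "(\<Sum>i\<in>B. \<Sum>g\<in>V \<rightarrow>\<^sub>E B. card (E \<inter> Pow (g -` {i}))) * card B ^ (n - 1)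
      = card B ^ (card V - n) * (card B * card B ^ (n - 1)) * card E"
    by (simp add: mult_ac)
  also have "\<dots> = card B ^ (card V - n) * card B ^ n * card E"
    using assms(3) by (simp flip: power_Suc)
  also have "\<dots> = card (V \<rightarrow>\<^sub>E B) * card E"
  proof (cases "E = {}")
    case False
    then have "n \<le> card V"
      using \<open>finite V\<close> \<open>E \<subseteq> Pow V\<close> assms(2) unfolding uniform_def by (metis Pow_iff card_mono ex_in_conv subsetD)
    then show ?thesis using \<open>finite V\<close> by (simp add: card_PiE flip: power_add)
  qed simp
  finally show ?thesis by (simp only: sum.swap[of _ B])
qed

lemma exists_partition_few_edges_inside_parts:
  assumes "hypergraph V E" "uniform n E" "1 \<le> n" "finite B" "B \<noteq> {}"
  shows "\<exists>g \<in> V \<rightarrow> B. (\<Sum>i\<in>B. card (E \<inter> Pow (g -` {i}))) * card B ^ (n - 1) \<le> card E"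
proof (rule ccontr)
  let ?inside = "\<lambda>g. \<Sum>i\<in>B. card (E \<inter> Pow (g -` {i}))"
  assume "\<not> ?thesis"
  then have many: "card E < ?inside g * card B ^ (n - 1)" if "g \<in> V \<rightarrow>\<^sub>E B" for g
    using that by (force simp: PiE_def)
  have "finite (V \<rightarrow>\<^sub>E B)" "V \<rightarrow>\<^sub>E B \<noteq> {}"
    using assms by (auto simp: hypergraph_def finite_PiE PiE_eq_empty_iff)
  then have "(\<Sum>g\<in>V \<rightarrow>\<^sub>E B. card E) < (\<Sum>g\<in>V \<rightarrow>\<^sub>E B. ?inside g * card B ^ (n - 1))"
    using many by (intro sum_strict_mono)
  then show False
    using sum_card_edges_inside_parts[OF assms(1-4)] by (simp add: sum_distrib_right)
qed

lemma max_chromatic_split: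
  assumes "2 \<le> n" "1 \<le> k"
  shows "\<exists>a. (\<Sum>i<k. a i) * k ^ (n - 1) \<le> N \<and> max_chromatic n N \<le> (\<Sum>i<k. max_chromatic n (a i))"
proof -
  obtain V :: "nat set" and E where VE: "hypergraph V E" "uniform n E" and "card E \<le> N"
    and extremal: "chromatic_number V E = max_chromatic n N"
    by (rule max_chromatic_attained[OF assms(1)])
  have edges: "E \<subseteq> Pow V" "\<And>e. e \<in> E \<Longrightarrow> 2 \<le> card e"
    using VE assms(1) by (auto simp: hypergraph_def uniform_def)
  obtain g where g: "g \<in> V \<rightarrow> {..<k}"
    and few: "(\<Sum>i<k. card (E \<inter> Pow (g -` {i}))) * k ^ (n - 1) \<le> card E"
    using exists_partition_few_edges_inside_parts[OF VE, of "{..<k}"] assms by fastforce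
  define a where "a i = card (E \<inter> Pow (g -` {i}))" for i
  have "colorable V E (\<Sum>i<k. max_chromatic n (a i))"
  proof (rule colorable_partition[OF _ g])
    fix i
    let ?V = "V \<inter> g -` {i}" and ?E = "E \<inter> Pow (g -` {i})"
    have part: "hypergraph ?V ?E" "uniform n ?E"
      using VE by (auto simp: hypergraph_def uniform_def)
    then have "chromatic_number ?V ?E \<le> max_chromatic n (a i)"
      using assms(1) by (intro chromatic_number_le_max_chromatic) (auto simp: a_def)
    then show "colorable ?V ?E (max_chromatic n (a i))"
      using chromatic_number_le_iff_colorable[OF part(1)] edges(2) by blast
  qed (use edges in force)+
  then have "max_chromatic n N \<le> (\<Sum>i<k. max_chromatic n (a i))"
    using chromatic_number_le_iff_colorable[OF VE(1) edges(2)] extremal by simp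
  moreover have "(\<Sum>i<k. a i) * k ^ (n - 1) \<le> N"
    using few \<open>card E \<le> N\<close> by (simp add: a_def)
  ultimately show ?thesis by blast
qed

section \<open>Tangents to the power function\<close>

lemma power_ge_tangent_plus_square:
  fixes z :: real
  assumes "0 \<le> z" "2 \<le> n"
  shows "1 + real n * (z - 1) + (z - 1)\<^sup>2 \<le> z ^ n"
  using assms(2)
proof (induction n rule: dec_induct)
  case base
  then show ?case by (simp add: power2_eq_square algebra_simps)
next
  case (step n)
  have "1 + real (Suc n) * (z - 1) + (z - 1)\<^sup>2
      \<le> 1 + real (Suc n) * (z - 1) + (z - 1)\<^sup>2 + (real n - 1 + z) * (z - 1)\<^sup>2"
    using step.hyps assms(1) by simp
  also have "\<dots> = z * (1 + real n * (z - 1) + (z - 1)\<^sup>2)"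
    by (simp add: power2_eq_square algebra_simps)
  also have "\<dots> \<le> z * z ^ n"
    using step.IH assms(1) by (rule mult_left_mono)
  finally show ?case by simp
qed

lemma tangent_ge_diagonal_plus_square:
  fixes z :: real
  assumes "0 \<le> z" "2 \<le> n"
  shows "z + (z - 1)\<^sup>2 / real n \<le> 1 + (z ^ n - 1) / real n"
proof -
  have "real n * (z - 1) + (z - 1)\<^sup>2 \<le> z ^ n - 1"
    using power_ge_tangent_plus_square[OF assms] by linarith
  then have "(real n * (z - 1) + (z - 1)\<^sup>2) / real n \<le> (z ^ n - 1) / real n"
    by (rule divide_right_mono) simp
  then show ?thesis using assms(2) by (simp add: add_divide_distrib)
qed

lemma square_mult_le_twice_square_diff:
  fixes t z :: real
  assumes "0 < t" "t \<le> 1" "1 + t \<le> z"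
  shows "t\<^sup>2 * z \<le> 2 * (z - 1)\<^sup>2"
proof -
  have "t * (z - 1) \<le> 1 * (z - 1)" using assms by (intro mult_right_mono) auto
  then have "t * z \<le> 2 * (z - 1)" using assms(3) by (simp add: right_diff_distrib)
  then have "t * (t * z) \<le> t * (2 * (z - 1))" using assms(1) by (intro mult_left_mono) auto
  also have "\<dots> \<le> (z - 1) * (2 * (z - 1))" using assms by (intro mult_right_mono) auto
  finally show ?thesis by (simp add: power2_eq_square algebra_simps)
qed

text \<open>
  With \<open>y = f a / (u * s)\<close> and \<open>z = root n a / s\<close>, the function \<open>1 + (z ^ n - 1) / n\<close> is the tangent
  to \<open>u * root n a\<close> at \<open>a = s ^ n\<close>, in units of \<open>u * s\<close>.
\<close>

lemma le_lowered_tangent: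
  fixes y z t :: real
  assumes "2 \<le> n" "0 \<le> z" "0 < t" "t \<le> 1"
    and \<delta>: "\<delta> = t\<^sup>2 / (6 * real n)"
    and upper: "y \<le> \<delta> + (1 + \<delta>) * z"
    and small: "z \<le> 1 + t \<Longrightarrow> y \<le> 1 - t"
  shows "y \<le> 1 - \<delta> + (z ^ n - 1) / real n"
proof -
  have "0 < \<delta>" using assms(1,3) by (simp add: \<delta>)
  have square_t: "t\<^sup>2 / real n = 6 * \<delta>" using assms(1) by (simp add: \<delta>)
  have tangent: "z + (z - 1)\<^sup>2 / real n \<le> 1 + (z ^ n - 1) / real n"
    by (rule tangent_ge_diagonal_plus_square[OF assms(2,1)])
  consider (left) "z \<le> 1 - t" | (near) "1 - t \<le> z" "z \<le> 1 + t" | (right) "1 + t \<le> z"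
    by linarith
  then show ?thesis
  proof cases
    case left
    then have "t\<^sup>2 \<le> (1 - z)\<^sup>2" using assms(3) by (intro power_mono) auto
    then have "t\<^sup>2 / real n \<le> (z - 1)\<^sup>2 / real n"
      by (intro divide_right_mono) (auto simp: power2_commute)
    then have "z + 6 * \<delta> \<le> 1 + (z ^ n - 1) / real n" using tangent square_t by linarith
    moreover have "\<delta> * z \<le> \<delta>" using left \<open>0 < \<delta>\<close> assms(3) by (simp add: mult_left_le)
    ultimately show ?thesis using upper[unfolded distrib_right mult_1] \<open>0 < \<delta>\<close> by linarith
  next
    case near
    have "1 - t + 6 * \<delta> \<le> 1 + ((1 - t) ^ n - 1) / real n"
      using tangent_ge_diagonal_plus_square[of "1 - t" n] square_t assms(1,4) by simp
    also have "\<dots> \<le> 1 + (z ^ n - 1) / real n"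
      using near assms(4) by (intro add_left_mono divide_right_mono diff_right_mono power_mono) auto
    finally show ?thesis using small[OF near(2)] \<open>0 < \<delta>\<close> by linarith
  next
    case right
    have "t\<^sup>2 / real n * z \<le> 2 * ((z - 1)\<^sup>2 / real n)"
      using square_mult_le_twice_square_diff[OF assms(3,4) right] by (simp add: divide_right_mono)
    then have "z + 3 * \<delta> * z \<le> 1 + (z ^ n - 1) / real n"
      using tangent unfolding square_t by linarith
    moreover have "\<delta> \<le> \<delta> * z" using right \<open>0 < \<delta>\<close> assms(3) by simp
    ultimately show ?thesis using upper[unfolded distrib_right mult_1] by linarith
  qed
qed

section \<open>Growth of splitting functions\<close>

lemma filterlim_root_at_top: "0 < n \<Longrightarrow> LIM x at_top. root n x :> at_top"
  by (rule filterlim_at_top_at_top[where Q="\<lambda>x. True" and P="\<lambda>x. 0 < x" and g="\<lambda>x. x ^ n"])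
     (auto intro: eventually_gt_at_top real_root_power_cancel)

lemma filterlim_root_real_at_top: "0 < n \<Longrightarrow> LIM N sequentially. root n (real N) :> at_top"
  using filterlim_compose[OF filterlim_root_at_top filterlim_real_sequentially] .

lemma tendsto_ceiling_divide:
  fixes s :: real
  assumes "0 < s" "filterlim f at_top F"
  shows "((\<lambda>x. real (nat \<lceil>f x / s\<rceil>) / f x) \<longlongrightarrow> 1 / s) F"
proof (rule tendsto_sandwich)
  have f_pos: "\<forall>\<^sub>F x in F. 0 < f x"
    using assms(2) by (simp add: filterlim_at_top_dense)
  then show "\<forall>\<^sub>F x in F. 1 / s \<le> real (nat \<lceil>f x / s\<rceil>) / f x"
  proof eventually_elim
    case (elim x)
    have "f x / s \<le> real (nat \<lceil>f x / s\<rceil>)" by linarith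
    then show ?case using elim by (simp add: field_simps)
  qed
  show "\<forall>\<^sub>F x in F. real (nat \<lceil>f x / s\<rceil>) / f x \<le> 1 / s + inverse (f x)"
    using f_pos
  proof eventually_elim
    case (elim x)
    have "0 \<le> f x / s" using elim assms(1) by simp
    then have "real (nat \<lceil>f x / s\<rceil>) \<le> f x / s + 1" by linarith
    then show ?case using elim by (simp add: field_simps)
  qed
  show "((\<lambda>x. 1 / s + inverse (f x)) \<longlongrightarrow> 1 / s) F"
    using tendsto_add[OF tendsto_const tendsto_inverse_0_at_top[OF assms(2)]] by simp
qed (rule tendsto_const)

lemma convergent_if_low_values_lower_upper_bound:
  fixes h :: "nat \<Rightarrow> real"
  assumes lower: "\<And>N. B \<le> h N" and upper: "\<forall>\<^sub>F N in sequentially. h N \<le> C"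
    and improve: "\<And>u l. l < u \<Longrightarrow> (\<And>v. u < v \<Longrightarrow> \<forall>\<^sub>F N in sequentially. h N \<le> v)
      \<Longrightarrow> \<exists>\<^sub>F N in sequentially. h N \<le> l \<Longrightarrow> \<exists>v<u. \<forall>\<^sub>F N in sequentially. h N \<le> v"
  shows "convergent h"
proof -
  define U where "U = {v. \<forall>\<^sub>F N in sequentially. h N \<le> v}"
  have "B \<le> v" if "v \<in> U" for v
    using eventually_happens'[OF sequentially_bot that[unfolded U_def mem_Collect_eq]] lower
    by (meson order_trans)
  then have "bdd_below U" by (rule bdd_belowI)
  have "U \<noteq> {}" using upper by (auto simp: U_def)
  have above: "\<forall>\<^sub>F N in sequentially. h N \<le> v" if v: "Inf U < v" for v
  proof -
    obtain w where "w \<in> U" "w < v" using cInf_lessD[OF \<open>U \<noteq> {}\<close> v] by blast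
    then show ?thesis unfolding U_def by (auto elim: eventually_mono)
  qed
  have below: "\<forall>\<^sub>F N in sequentially. l < h N" if l: "l < Inf U" for l
  proof (rule ccontr)
    assume "\<not> ?thesis"
    then have "\<exists>\<^sub>F N in sequentially. h N \<le> l" by (simp add: not_eventually not_less)
    then obtain v where "v < Inf U" "v \<in> U" using improve[OF l above] unfolding U_def by blast
    then show False using cInf_lower[OF \<open>v \<in> U\<close> \<open>bdd_below U\<close>] by simp
  qed
  have "h \<longlonglongrightarrow> Inf U"
  proof (rule order_tendstoI)
    fix v assume "Inf U < v"
    then obtain w where "Inf U < w" "w < v" using dense by blast
    then show "\<forall>\<^sub>F N in sequentially. h N < v" using above[of w] by (auto elim: eventually_mono)
  qed (rule below)
  then show ?thesis by (rule convergentI)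
qed

locale splitting_function =
  fixes n :: nat and f :: "nat \<Rightarrow> real"
  assumes exponent: "2 \<le> n"
    and nonneg: "0 \<le> f N"
    and mono: "N \<le> N' \<Longrightarrow> f N \<le> f N'"
    and split: "1 \<le> k \<Longrightarrow> \<exists>a. (\<Sum>i<k. a i) * k ^ (n - 1) \<le> N \<and> f N \<le> (\<Sum>i<k. f (a i))"
begin

definition ratio :: "nat \<Rightarrow> real" where
  "ratio N = f N / root n (real N)"

lemma ratio_nonneg: "0 \<le> ratio N"
  using nonneg exponent by (simp add: ratio_def)

lemma le_split_affine:
  assumes affine: "\<And>a. f a \<le> \<alpha> + \<beta> * real a" and "0 \<le> \<beta>" "1 \<le> k"
  shows "f N \<le> \<alpha> * real k + \<beta> * (real N / real k ^ (n - 1))"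
proof -
  obtain a where a: "(\<Sum>i<k. a i) * k ^ (n - 1) \<le> N" "f N \<le> (\<Sum>i<k. f (a i))"
    using split[OF assms(3)] by blast
  have "real ((\<Sum>i<k. a i) * k ^ (n - 1)) \<le> real N" using a(1) by (simp only: of_nat_le_iff)
  then have sum_le: "(\<Sum>i<k. real (a i)) \<le> real N / real k ^ (n - 1)"
    using assms(3) by (simp add: field_simps)
  have "f N \<le> (\<Sum>i<k. \<alpha> + \<beta> * real (a i))"
    using a(2) affine by (meson sum_mono order_trans)
  also have "\<dots> = \<alpha> * real k + \<beta> * (\<Sum>i<k. real (a i))"
    by (simp add: sum.distrib sum_distrib_left)
  finally show ?thesis using mult_left_mono[OF sum_le assms(2)] by linarith
qed

lemma eventually_ratio_le_affine:
  assumes affine: "\<And>a. f a \<le> \<alpha> + \<beta> * real a" and "0 \<le> \<beta>" "0 < s"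
    and v: "\<alpha> / s + \<beta> * s ^ (n - 1) < v"
  shows "\<forall>\<^sub>F N in sequentially. ratio N \<le> v"
proof -
  define T where "T N = root n (real N)" for N
  define k where "k N = nat \<lceil>T N / s\<rceil>" for N
  have T_top: "filterlim T at_top sequentially"
    unfolding T_def using exponent by (intro filterlim_root_real_at_top) simp
  have lim: "(\<lambda>N. real (k N) / T N) \<longlonglongrightarrow> 1 / s"
    unfolding k_def by (rule tendsto_ceiling_divide[OF assms(3) T_top])
  then have "(\<lambda>N. \<alpha> * (real (k N) / T N) + \<beta> * inverse (real (k N) / T N) ^ (n - 1))
      \<longlonglongrightarrow> \<alpha> * (1 / s) + \<beta> * inverse (1 / s) ^ (n - 1)"
    using assms(3) by (intro tendsto_add tendsto_mult_left tendsto_power tendsto_inverse lim) auto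
  then have "\<forall>\<^sub>F N in sequentially.
      \<alpha> * (real (k N) / T N) + \<beta> * inverse (real (k N) / T N) ^ (n - 1) < v"
    using v by (intro order_tendstoD(2)) auto
  moreover have "\<forall>\<^sub>F N in sequentially. 0 < T N"
    using T_top by (simp add: filterlim_at_top_dense)
  ultimately show ?thesis
  proof eventually_elim
    case (elim N)
    have "1 \<le> k N" using elim(2) assms(3) by (simp add: k_def Suc_le_eq)
    have "real N = T N * T N ^ (n - 1)"
      using exponent by (simp add: T_def flip: power_Suc)
    then have "\<alpha> * real (k N) + \<beta> * (real N / real (k N) ^ (n - 1))
        = (\<alpha> * (real (k N) / T N) + \<beta> * inverse (real (k N) / T N) ^ (n - 1)) * T N"
      using elim(2) by (simp add: power_divide distrib_right)
    then have "f N \<le> v * T N"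
      using le_split_affine[OF affine assms(2) \<open>1 \<le> k N\<close>, of N] elim by (smt (verit) mult_right_mono)
    then show ?case using elim(2) by (simp add: ratio_def T_def[symmetric] pos_divide_le_eq)
  qed
qed

lemma eq_ratio_times_root: "1 \<le> N \<Longrightarrow> f N = ratio N * root n (real N)"
  using exponent by (simp add: ratio_def)

lemma le_const_plus_root:
  assumes "\<forall>\<^sub>F N in sequentially. ratio N \<le> v" "0 \<le> v"
  obtains K where "\<And>a. f a \<le> K + v * root n (real a)"
proof -
  obtain M where M: "\<And>N. M \<le> N \<Longrightarrow> ratio N \<le> v"
    using assms(1) by (auto simp: eventually_sequentially)
  have "f a \<le> f (Suc M) + v * root n (real a)" for a
  proof (cases "a \<le> Suc M")
    case True
    have "0 \<le> v * root n (real a)" using assms(2) exponent by simp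
    then show ?thesis using mono[OF True] by linarith
  next
    case False
    then have "f a \<le> v * root n (real a)"
      using eq_ratio_times_root[of a] M[of a] exponent by (simp add: mult_right_mono)
    then show ?thesis using nonneg[of "Suc M"] by linarith
  qed
  then show ?thesis using that by blast
qed

lemma le_lowered_tangent_affine:
  fixes u s t :: real
  assumes "0 < u" "0 < s" "0 < t" "t \<le> 1"
    and \<delta>: "\<delta> = t\<^sup>2 / (6 * real n)"
    and upper: "\<And>a. f a \<le> \<delta> * (u * s) + (1 + \<delta>) * u * root n (real a)"
    and x: "root n (real x) = (1 + t) * s" "f x \<le> (1 - t) * (u * s)"
  shows "f a \<le> u * s * (1 - \<delta> - 1 / real n) + u * s / (real n * s ^ n) * real a"
proof -
  define z where "z = root n (real a) / s"
  have "z ^ n = real a / s ^ n" using exponent by (simp add: z_def power_divide)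
  have "f a / (u * s) \<le> 1 - \<delta> + (z ^ n - 1) / real n"
  proof (rule le_lowered_tangent[OF exponent _ assms(3,4) \<delta>])
    show "0 \<le> z" using assms(2) exponent by (simp add: z_def)
    show "f a / (u * s) \<le> \<delta> + (1 + \<delta>) * z"
      using upper[of a] assms(1,2) by (simp add: z_def field_simps)
    assume "z \<le> 1 + t"
    then have "root n (real a) \<le> root n (real x)"
      using assms(2) by (simp add: z_def x(1) pos_divide_le_eq)
    then have "f a \<le> f x" using exponent by (intro mono) simp
    then show "f a / (u * s) \<le> 1 - t" using x(2) assms(1,2) by (simp add: pos_divide_le_eq)
  qed
  then have "f a \<le> u * s * (1 - \<delta> + (z ^ n - 1) / real n)"
    using assms(1,2) by (simp add: pos_divide_le_eq mult.commute)
  also have "\<dots> = u * s * (1 - \<delta> - 1 / real n) + u * s / (real n * s ^ n) * real a"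
    by (simp add: \<open>z ^ n = real a / s ^ n\<close> diff_divide_distrib algebra_simps)
  finally show ?thesis .
qed

lemma eventually_ratio_le_lowered_tangent:
  fixes u s t :: real
  assumes "0 < u" "0 < s" "0 < t" "t \<le> 1"
    and \<delta>: "\<delta> = t\<^sup>2 / (6 * real n)"
    and "\<And>a. f a \<le> \<delta> * (u * s) + (1 + \<delta>) * u * root n (real a)"
    and "root n (real x) = (1 + t) * s" "f x \<le> (1 - t) * (u * s)"
  shows "\<forall>\<^sub>F N in sequentially. ratio N \<le> u * (1 - \<delta> / 2)"
proof (rule eventually_ratio_le_affine[OF le_lowered_tangent_affine[OF assms] _ assms(2)])
  have "0 < \<delta>" using assms(3) exponent by (simp add: \<delta>)
  have "s ^ n = s * s ^ (n - 1)" using exponent by (simp flip: power_Suc)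
  then have "u * s * (1 - \<delta> - 1 / real n) / s + u * s / (real n * s ^ n) * s ^ (n - 1) = u * (1 - \<delta>)"
    using assms(2) exponent by (simp add: field_simps)
  also have "\<dots> < u * (1 - \<delta> / 2)" using assms(1) \<open>0 < \<delta>\<close> by simp
  finally show "u * s * (1 - \<delta> - 1 / real n) / s + u * s / (real n * s ^ n) * s ^ (n - 1)
      < u * (1 - \<delta> / 2)" .
qed (use assms(1,2) in simp)

lemma frequently_ratio_le_lowers_upper_bound:
  assumes "l < u" and upper: "\<And>v. u < v \<Longrightarrow> \<forall>\<^sub>F N in sequentially. ratio N \<le> v"
    and low: "\<exists>\<^sub>F N in sequentially. ratio N \<le> l"
  shows "\<exists>v<u. \<forall>\<^sub>F N in sequentially. ratio N \<le> v"
proof -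
  have "0 \<le> l" using frequently_ex[OF low] ratio_nonneg order_trans by blast
  then have "0 < u" using assms(1) by simp
  define t where "t = (u - l) / (u + l)"
  have t: "0 < t" "t \<le> 1" "l * (1 + t) = (1 - t) * u"
    using assms(1) \<open>0 \<le> l\<close> \<open>0 < u\<close> by (auto simp: t_def field_simps)
  define \<delta> where "\<delta> = t\<^sup>2 / (6 * real n)"
  have "0 < \<delta>" using t(1) exponent by (simp add: \<delta>_def)
  then have "\<forall>\<^sub>F N in sequentially. ratio N \<le> (1 + \<delta>) * u"
    using \<open>0 < u\<close> by (intro upper) simp
  moreover have "0 \<le> (1 + \<delta>) * u" using \<open>0 < u\<close> \<open>0 < \<delta>\<close> by simp
  ultimately obtain K where K: "\<And>a. f a \<le> K + (1 + \<delta>) * u * root n (real a)"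
    using le_const_plus_root by blast
  have "\<forall>\<^sub>F N in sequentially. (1 + t) * K / (\<delta> * u) \<le> root n (real N)"
    using filterlim_root_real_at_top[of n] exponent by (simp add: filterlim_at_top)
  then have "\<forall>\<^sub>F N in sequentially. 1 \<le> N \<and> (1 + t) * K / (\<delta> * u) \<le> root n (real N)"
    using eventually_ge_at_top by (rule eventually_conj[rotated])
  then obtain x where x: "1 \<le> x" "(1 + t) * K / (\<delta> * u) \<le> root n (real x)" "ratio x \<le> l"
    using frequently_ex[OF frequently_eventually_conj[OF low]] by blast
  define s where "s = root n (real x) / (1 + t)"
  have "0 < s" using x(1) t(1) exponent by (simp add: s_def)
  have root_x: "root n (real x) = (1 + t) * s" using t(1) by (simp add: s_def)
  have "f x \<le> l * ((1 + t) * s)"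
    using eq_ratio_times_root[OF x(1)] x(3) \<open>0 < s\<close> t(1) by (simp add: root_x mult_right_mono)
  then have f_x: "f x \<le> (1 - t) * (u * s)" using t(3) by (simp add: mult.assoc[symmetric])
  have "K \<le> \<delta> * (u * s)"
    using x(2) \<open>0 < \<delta>\<close> \<open>0 < u\<close> t(1) by (simp add: s_def field_simps)
  then have "f a \<le> \<delta> * (u * s) + (1 + \<delta>) * u * root n (real a)" for a
    using K[of a] by linarith
  then have "\<forall>\<^sub>F N in sequentially. ratio N \<le> u * (1 - \<delta> / 2)"
    by (rule eventually_ratio_le_lowered_tangent[OF \<open>0 < u\<close> \<open>0 < s\<close> t(1,2) \<delta>_def _ root_x f_x])
  moreover have "u * (1 - \<delta> / 2) < u" using \<open>0 < u\<close> \<open>0 < \<delta>\<close> by simp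
  ultimately show ?thesis by blast
qed

lemma convergent_ratio:
  assumes "\<And>a. f a \<le> \<alpha> + \<beta> * real a" "0 \<le> \<beta>"
  shows "convergent ratio"
proof (rule convergent_if_low_values_lower_upper_bound)
  show "\<forall>\<^sub>F N in sequentially. ratio N \<le> \<alpha> + \<beta> + 1"
    by (rule eventually_ratio_le_affine[OF assms, of 1]) simp_all
qed (use ratio_nonneg frequently_ratio_le_lowers_upper_bound in blast)+

end

section \<open>Inversion of the growth rate\<close>

lemma tendsto_pred_divide_root:
  fixes f :: "nat \<Rightarrow> real"
  assumes "(\<lambda>N. f N / root n (real N)) \<longlonglongrightarrow> L" "0 < n"
  shows "(\<lambda>N. f (N - 1) / root n (real N)) \<longlonglongrightarrow> L"
proof -
  have "(\<lambda>N. root n (real N / real (Suc N))) \<longlonglongrightarrow> root n 1"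
    by (intro tendsto_real_root LIMSEQ_n_over_Suc_n)
  then have "(\<lambda>N. f N / root n (real N) * root n (real N / real (Suc N))) \<longlonglongrightarrow> L"
    using tendsto_mult[OF assms(1)] assms(2) by fastforce
  moreover have "f N / root n (real N) * root n (real N / real (Suc N)) = f N / root n (real (Suc N))"
    if "1 \<le> N" for N
    using that assms(2) by (simp add: real_root_divide)
  ultimately have "(\<lambda>N. f N / root n (real (Suc N))) \<longlonglongrightarrow> L"
    by (rule Lim_transform_eventually[OF _ eventually_sequentiallyI])
  then show ?thesis by (subst filterlim_sequentially_Suc[symmetric]) simp
qed

lemma tendsto_galois_inverse:
  fixes F g :: "nat \<Rightarrow> nat"
  assumes galois: "\<And>N r. N < g r \<longleftrightarrow> F N \<le> r" and "0 < n"
    and lim: "(\<lambda>N. real (F N) / root n (real N)) \<longlonglongrightarrow> L"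
  shows "(\<lambda>r. real r / root n (real (g r))) \<longlonglongrightarrow> L"
proof (rule tendsto_sandwich)
  have eventually_le_g: "\<forall>\<^sub>F r in sequentially. Z \<le> g r" for Z
    using galois by (intro eventually_sequentiallyI[of "F Z"]) (simp add: less_imp_le)
  then have g_at_top: "LIM r sequentially. g r :> sequentially"
    by (simp add: filterlim_at_top)
  show "(\<lambda>r. real (F (g r - 1)) / root n (real (g r))) \<longlonglongrightarrow> L"
    using tendsto_pred_divide_root[OF lim assms(2)] g_at_top by (rule filterlim_compose)
  show "(\<lambda>r. real (F (g r)) / root n (real (g r))) \<longlonglongrightarrow> L"
    using lim g_at_top by (rule filterlim_compose)
  show "\<forall>\<^sub>F r in sequentially. real (F (g r - 1)) / root n (real (g r)) \<le> real r / root n (real (g r))"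
    using eventually_le_g[of 1]
  proof eventually_elim
    case (elim r)
    then have "F (g r - 1) \<le> r" using galois[of "g r - 1" r] by simp
    then show ?case using assms(2) by (intro divide_right_mono) auto
  qed
  have "r \<le> F (g r)" for r using galois[of "g r" r] by simp
  then show "\<forall>\<^sub>F r in sequentially. real r / root n (real (g r)) \<le> real (F (g r)) / root n (real (g r))"
    using assms(2) by (intro always_eventually allI divide_right_mono) auto
qed

lemma splitting_function_max_chromatic:
  assumes "2 \<le> n"
  shows "splitting_function n (\<lambda>N. real (max_chromatic n N))"
proof
  fix N k :: nat
  assume "1 \<le> k"
  then show "\<exists>a. (\<Sum>i<k. a i) * k ^ (n - 1) \<le> N
      \<and> real (max_chromatic n N) \<le> (\<Sum>i<k. real (max_chromatic n (a i)))"
    using max_chromatic_split[OF assms] by (metis of_nat_le_iff of_nat_sum)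
qed (use assms max_chromatic_mono in auto)

lemma inverse_le_divide_root_m:
  assumes "2 \<le> n" "1 \<le> r"
  shows "1 / real n \<le> real r / root n (real (m n r))"
proof -
  have "0 < m n r"
    using max_chromatic_le_Suc[OF assms(1), of 0] assms(2) by (simp add: less_m_iff_max_chromatic_le[OF assms(1)])
  have "real (m n r) \<le> (real r * real n) ^ n"
    using m_le_power[OF assms] by (metis of_nat_le_iff of_nat_mult of_nat_power)
  then have "root n (real (m n r)) \<le> root n ((real r * real n) ^ n)" using assms(1) by simp
  also have "\<dots> = real r * real n" using assms(1) by (simp add: real_root_power_cancel)
  finally show ?thesis using \<open>0 < m n r\<close> assms(1) by (simp add: field_simps)
qed

theorem theorem1:
  fixes n :: nat
  assumes "n \<ge> 2"
  shows "convergent (\<lambda>r. real (m n r) / real r ^ n)"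
proof -
  let ?q = "\<lambda>r. real r / root n (real (m n r))"
  interpret splitting_function n "\<lambda>N. real (max_chromatic n N)"
    by (rule splitting_function_max_chromatic[OF assms])
  have "real (max_chromatic n N) \<le> 1 + 1 * real N" for N
    using max_chromatic_le_Suc[OF assms, of N] by simp
  then have "convergent ratio" by (rule convergent_ratio) simp
  then obtain L where "ratio \<longlonglongrightarrow> L" unfolding convergent_def by blast
  then have q_lim: "?q \<longlonglongrightarrow> L"
    using assms unfolding ratio_def
    by (intro tendsto_galois_inverse[OF less_m_iff_max_chromatic_le]) auto
  have "1 / real n \<le> L"
    by (rule tendsto_lowerbound[OF q_lim eventually_sequentiallyI]) (auto intro: inverse_le_divide_root_m[OF assms])
  then have "L \<noteq> 0" using assms by auto
  then have "(\<lambda>r. inverse (?q r) ^ n) \<longlonglongrightarrow> inverse L ^ n" by (intro tendsto_intros q_lim)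
  moreover have "inverse (?q r) ^ n = real (m n r) / real r ^ n" for r
    using assms by (simp add: power_divide)
  ultimately show ?thesis by (auto intro: convergentI)
qed

end
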